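(* Let $Q^\sigma$ be a signed quiver and $\varphi\in Q_1$ a signed non-loop arrow. Let $\mathrm{Ins}_\varphi(Q)$ be the signed quiver obtained by inserting a new $\sigma(\varphi)$-signed vertex $a$ and replacing $\varphi$ by an unsigned arrow $\psi:t\varphi\to a$. Then the indecomposable symmetric representations of $\widetilde{Q}$ are (up to isomorphism) exactly the representations $\mathrm{Del}_a(W)$, where $W$ runs over all indecomposable symmetric representations of $\widetilde{\mathrm{Ins}_\varphi(Q)}$ such that $W(\psi)$ is surjective.
   Context: $\mathbf{k}$ is an algebraically closed field of characteristic $0$; vector spaces are finite-dimensional. A quiver $Q$ is a finite oriented graph with vertex set $Q_0$ and arrow set $Q_1$; $t\varphi,h\varphi$ are the tail and head of an arrow $\varphi$. A representation $V$ assigns a $\mathbf{k}$-space $V(i)$ to each vertex and a linear map $V(\varphi):V(t\varphi)\to V(h\varphi)$ to each arrow. Signed quiver: a signed quiver $Q^\sigma$ is a quiver $Q$ with a function $\sigma:Q_0\sqcup Q_1\to\{-1,0,1\}$ and a choice of $m\ge 0$ disjoint pairs $\{i,i^*\}$ of distinct vertices, called twins. A vertex or arrow is called signed if its $\sigma$ is nonzero, unsigned otherwise. Axioms: (1) twins are unsigned; (2) a non-loop arrow is signed iff its two endpoints are twins of each other; (3) a loop is signed iff its vertex is signed. Associated symmetric quiver $\widetilde{Q}$: add to $Q$ a new vertex $j^*$ for each unsigned vertex $j$ that is not in a twin pair, and a new arrow $\varphi^*:(h\varphi)^*\to(t\varphi)^*$ for each unsigned arrow $\varphi$ of $Q$.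 The involution $*$ on $\widetilde{Q}_0$ and $\widetilde{Q}_1$ exchanges $i\leftrightarrow i^*$ and $\varphi\leftrightarrow\varphi^*$ and fixes signed vertices and signed arrows; new vertices and arrows have $\sigma=0$. Dual representation: for $\varphi\in\widetilde{Q}_1$ let $s_\varphi=-1$ if exactly one of $\sigma(\varphi)=-1$, $\sigma(h\varphi)=-1$ holds, and $s_\varphi=1$ otherwise. For a representation $V$ of $\widetilde{Q}$, $V^*(i)=(V(i^* ))^*$ and $V^*(\varphi)=s_\varphi V(\varphi^* )^*$. A signed form on spaces $V(i)$ ($i\in\widetilde{Q}_0$) is a collection of isomorphisms $J_i:V(i)\to(V(i^* ))^*$ with $J_{i^*}=(J_i)^*$ if $i\ne i^*$ and $(J_i)^*=\sigma(i)J_i$ if $i=i^*$. A representation $V$ of $\widetilde{Q}$ is symmetric if there is given a signed form $J$ such that $(J_i)$ is an isomorphism of representations $V\to V^*$. The direct sum of symmetric representations is symmetric with respect to the direct sum of the forms. A nonzero symmetric representation is called indecomposable (as a symmetric representation) if it is not isomorphic to a direct sum of two nonzero symmetric representations. Ins and Del: with $\varphi$ as in the claim, the vertices $t\varphi$ and $h\varphi=(t\varphi)^*$ are twins, and $\widetilde{\mathrm{Ins}_\varphi(Q)}$ is $\widetilde{Q}$ with the arrow $\varphi$ (fixed by $*$) replaced by a new vertex $a=a^*$ with $\sigma(a)=\sigma(\varphi)$ and two unsigned arrows $\psi:t\varphi\to a$, $\psi^*:a\to h\varphi$ exchanged by $*$. For a representation $W$ of $\widetilde{\mathrm{Ins}_\varphi(Q)}$,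 $\mathrm{Del}_a(W)$ is the representation of $\widetilde{Q}$ that agrees with $W$ on all vertices other than $a$ and all arrows other than $\varphi$, and has $\mathrm{Del}_a(W)(\varphi)=W(\psi^* )W(\psi)$. If $W$ is symmetric, so is $\mathrm{Del}_a(W)$, with the restricted signed form. *)

theory Defs
  imports
    "HOL-Computational_Algebra.Polynomial"
    "HOL-Library.Function_Algebras"
    "HOL-Library.Product_Plus"
    "Graph_Theory.Digraph"
begin

section \<open>Signed quivers and their symmetric quivers\<close>

record ('v, 'a) sgn_digraph = "('v, 'a) pre_digraph" +
  vsign :: "'v \<Rightarrow> int"
  asign :: "'a \<Rightarrow> int"

record ('v, 'a) signed_quiver = "('v, 'a) sgn_digraph" +
  twins :: "'v set set"

record ('v, 'a) symm_quiver = "('v, 'a) sgn_digraph" +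
  vstar :: "'v \<Rightarrow> 'v"
  astar :: "'a \<Rightarrow> 'a"

locale signed_quiver =
  fixes Q :: "('v, 'a) signed_quiver"
  assumes quiver: "fin_digraph (pre_digraph.truncate Q)"
    and vsign_range: "i \<in> verts Q \<Longrightarrow> vsign Q i \<in> {-1, 0, 1}"
    and asign_range: "\<alpha> \<in> arcs Q \<Longrightarrow> asign Q \<alpha> \<in> {-1, 0, 1}"
    and twins_pairs: "T \<in> twins Q \<Longrightarrow> T \<subseteq> verts Q \<and> card T = 2"
    and twins_disjoint: "pairwise disjnt (twins Q)"
    and twins_unsigned: "i \<in> \<Union> (twins Q) \<Longrightarrow> vsign Q i = 0"
    and nonloop_signed_iff: "\<lbrakk>\<alpha> \<in> arcs Q; tail Q \<alpha> \<noteq> head Q \<alpha>\<rbrakk> \<Longrightarrow>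
          asign Q \<alpha> \<noteq> 0 \<longleftrightarrow> {tail Q \<alpha>, head Q \<alpha>} \<in> twins Q"
    and loop_signed_iff: "\<lbrakk>\<alpha> \<in> arcs Q; tail Q \<alpha> = head Q \<alpha>\<rbrakk> \<Longrightarrow>
          asign Q \<alpha> \<noteq> 0 \<longleftrightarrow> vsign Q (tail Q \<alpha>) \<noteq> 0"

definition twin :: "('v, 'a) signed_quiver \<Rightarrow> 'v \<Rightarrow> 'v" where
  "twin Q i = (THE j. j \<noteq> i \<and> {i, j} \<in> twins Q)"

text \<open>The vertices and arrows of the symmetric quiver are those of the form \<open>Orig x\<close>, for the
  vertices and arrows \<open>x\<close> of \<open>Q\<close>, together with the newly added ones \<open>Star x\<close>. An
  element \<open>Star x\<close> exists only where one has to be added: if \<open>i\<close> and \<open>j\<close> are twins, the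
  involution sends \<open>Orig i\<close> to \<open>Orig j\<close>.\<close>

datatype 'x dbl = Orig 'x | Star 'x

fun star_vert :: "('v, 'a) signed_quiver \<Rightarrow> 'v dbl \<Rightarrow> 'v dbl" where
  "star_vert Q (Orig i) =
     (if i \<in> \<Union> (twins Q) then Orig (twin Q i)
      else if vsign Q i \<noteq> 0 then Orig i else Star i)"
| "star_vert Q (Star i) = Orig i"

fun star_arc :: "('v, 'a) signed_quiver \<Rightarrow> 'a dbl \<Rightarrow> 'a dbl" where
  "star_arc Q (Orig \<alpha>) = (if asign Q \<alpha> \<noteq> 0 then Orig \<alpha> else Star \<alpha>)"
| "star_arc Q (Star \<alpha>) = Orig \<alpha>"

definition assoc_symm_quiver :: "('v, 'a) signed_quiver \<Rightarrow> ('v dbl, 'a dbl) symm_quiver" where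
  "assoc_symm_quiver Q =
     \<lparr>verts = Orig ` verts Q \<union> Star ` {j \<in> verts Q. vsign Q j = 0 \<and> j \<notin> \<Union> (twins Q)},
      arcs = Orig ` arcs Q \<union> Star ` {\<alpha> \<in> arcs Q. asign Q \<alpha> = 0},
      tail = (\<lambda>x. case x of Orig \<alpha> \<Rightarrow> Orig (tail Q \<alpha>) | Star \<alpha> \<Rightarrow> star_vert Q (Orig (head Q \<alpha>))),
      head = (\<lambda>x. case x of Orig \<alpha> \<Rightarrow> Orig (head Q \<alpha>) | Star \<alpha> \<Rightarrow> star_vert Q (Orig (tail Q \<alpha>))),
      vsign = (\<lambda>x. case x of Orig i \<Rightarrow> vsign Q i | Star i \<Rightarrow> 0),
      asign = (\<lambda>x. case x of Orig \<alpha> \<Rightarrow> asign Q \<alpha> | Star \<alpha> \<Rightarrow> 0),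
      vstar = star_vert Q,
      astar = star_arc Q\<rparr>"

text \<open>In \<open>insertion \<phi> Q\<close> the new vertex \<open>a\<close> and the new arrow \<open>\<psi>\<close> are both named \<open>None\<close>; an old
  vertex or arrow \<open>x\<close> is named \<open>Some x\<close>. Thus, in the associated symmetric quiver, the vertex \<open>a\<close>
  is \<open>Orig None\<close>, and the arrows \<open>\<psi>\<close> and \<open>\<psi>\<^sup>*\<close> are \<open>Orig None\<close> and \<open>Star None\<close>.\<close>

definition insertion :: "'a \<Rightarrow> ('v, 'a) signed_quiver \<Rightarrow> ('v option, 'a option) signed_quiver" where
  "insertion \<phi> Q =
     \<lparr>verts = insert None (Some ` verts Q),
      arcs = insert None (Some ` (arcs Q - {\<phi>})),
      tail = (\<lambda>x. case x of None \<Rightarrow> Some (tail Q \<phi>) | Some \<alpha> \<Rightarrow> Some (tail Q \<alpha>)),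
      head = (\<lambda>x. case x of None \<Rightarrow> None | Some \<alpha> \<Rightarrow> Some (head Q \<alpha>)),
      vsign = (\<lambda>x. case x of None \<Rightarrow> asign Q \<phi> | Some i \<Rightarrow> vsign Q i),
      asign = (\<lambda>x. case x of None \<Rightarrow> 0 | Some \<alpha> \<Rightarrow> asign Q \<alpha>),
      twins = (`) Some ` twins Q\<rparr>"

section \<open>Subspaces, linear maps and duals\<close>

definition fin_dim_subspace :: "('k::field \<Rightarrow> 'b::ab_group_add \<Rightarrow> 'b) \<Rightarrow> 'b set \<Rightarrow> bool" where
  "fin_dim_subspace scale S \<longleftrightarrow> (\<exists>B. finite B \<and> S = module.span scale B)"

definition linear_between :: "('k::field \<Rightarrow> 'b::ab_group_add \<Rightarrow> 'b) \<Rightarrow> ('k \<Rightarrow> 'c::ab_group_add \<Rightarrow> 'c) \<Rightarrow>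
    'b set \<Rightarrow> 'c set \<Rightarrow> ('b \<Rightarrow> 'c) \<Rightarrow> bool" where
  "linear_between s1 s2 S T f \<longleftrightarrow>
     (\<forall>x\<in>S. f x \<in> T) \<and>
     (\<forall>x\<in>S. \<forall>y\<in>S. f (x + y) = f x + f y) \<and>
     (\<forall>c. \<forall>x\<in>S. f (s1 c x) = s2 c (f x))"

definition linear_iso_between :: "('k::field \<Rightarrow> 'b::ab_group_add \<Rightarrow> 'b) \<Rightarrow> ('k \<Rightarrow> 'c::ab_group_add \<Rightarrow> 'c) \<Rightarrow>
    'b set \<Rightarrow> 'c set \<Rightarrow> ('b \<Rightarrow> 'c) \<Rightarrow> bool" where
  "linear_iso_between s1 s2 S T f \<longleftrightarrow> linear_between s1 s2 S T f \<and> bij_betw f S T"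

text \<open>A functional on a subspace \<open>S\<close> is represented by its extension by \<open>0\<close> (in general not
  linear outside \<open>S\<close>), so that the dual of \<open>S\<close> is a subspace of the function space.\<close>

definition fun_scale :: "'k::field \<Rightarrow> ('b \<Rightarrow> 'k) \<Rightarrow> 'b \<Rightarrow> 'k" where
  "fun_scale c f = (\<lambda>x. c * f x)"

definition dual_space :: "('k::field \<Rightarrow> 'b::ab_group_add \<Rightarrow> 'b) \<Rightarrow> 'b set \<Rightarrow> ('b \<Rightarrow> 'k) set" where
  "dual_space scale S = {f. linear_between scale (*) S UNIV f \<and> (\<forall>x. x \<notin> S \<longrightarrow> f x = 0)}"

definition dual_map :: "'b set \<Rightarrow> ('b \<Rightarrow> 'c) \<Rightarrow> ('c \<Rightarrow> 'k::zero) \<Rightarrow> ('b \<Rightarrow> 'k)" where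
  "dual_map S f g = (\<lambda>x. if x \<in> S then g (f x) else 0)"

definition prod_scale :: "('k \<Rightarrow> 'b \<Rightarrow> 'b) \<Rightarrow> ('k \<Rightarrow> 'c \<Rightarrow> 'c) \<Rightarrow> 'k \<Rightarrow> 'b \<times> 'c \<Rightarrow> 'b \<times> 'c" where
  "prod_scale s1 s2 c = map_prod (s1 c) (s2 c)"

section \<open>Representations\<close>

text \<open>The spaces of a representation are finite-dimensional subspaces of one ambient vector space
  \<open>'b\<close>. This loses nothing, because the finitely many spaces of a representation embed into their
  direct sum. Only the restrictions of the maps to the spaces at the tails of the arrows matter.\<close>

record ('v, 'a, 'b) rep =
  vspace :: "'v \<Rightarrow> 'b set"
  vmap :: "'a \<Rightarrow> 'b \<Rightarrow> 'b"

record ('v, 'a, 'b, 'k) form_rep = "('v, 'a, 'b) rep" +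
  form :: "'v \<Rightarrow> 'b \<Rightarrow> ('b \<Rightarrow> 'k)"

definition is_rep :: "('k::field \<Rightarrow> 'b::ab_group_add \<Rightarrow> 'b) \<Rightarrow> ('v, 'a, 'q) pre_digraph_scheme \<Rightarrow>
    ('v, 'a, 'b, 'r) rep_scheme \<Rightarrow> bool" where
  "is_rep scale G V \<longleftrightarrow>
     (\<forall>i\<in>verts G. fin_dim_subspace scale (vspace V i)) \<and>
     (\<forall>\<alpha>\<in>arcs G. linear_between scale scale
        (vspace V (tail G \<alpha>)) (vspace V (head G \<alpha>)) (vmap V \<alpha>))"

definition is_rep_iso :: "('k::field \<Rightarrow> 'b::ab_group_add \<Rightarrow> 'b) \<Rightarrow> ('k \<Rightarrow> 'c::ab_group_add \<Rightarrow> 'c) \<Rightarrow>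
    ('v, 'a, 'q) pre_digraph_scheme \<Rightarrow> ('v, 'a, 'b, 'r) rep_scheme \<Rightarrow> ('v, 'a, 'c, 's) rep_scheme \<Rightarrow>
    ('v \<Rightarrow> 'b \<Rightarrow> 'c) \<Rightarrow> bool" where
  "is_rep_iso s1 s2 G V V' f \<longleftrightarrow>
     (\<forall>i\<in>verts G. linear_iso_between s1 s2 (vspace V i) (vspace V' i) (f i)) \<and>
     (\<forall>\<alpha>\<in>arcs G. \<forall>x\<in>vspace V (tail G \<alpha>).
        f (head G \<alpha>) (vmap V \<alpha> x) = vmap V' \<alpha> (f (tail G \<alpha>) x))"

definition dual_sign :: "('v, 'a, 'q) sgn_digraph_scheme \<Rightarrow> 'a \<Rightarrow> 'k::field" where
  "dual_sign G \<alpha> = (if (asign G \<alpha> = -1) \<noteq> (vsign G (head G \<alpha>) = -1) then -1 else 1)"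

definition dual_rep :: "('k::field \<Rightarrow> 'b::ab_group_add \<Rightarrow> 'b) \<Rightarrow> ('v, 'a) symm_quiver \<Rightarrow>
    ('v, 'a, 'b, 'r) rep_scheme \<Rightarrow> ('v, 'a, 'b \<Rightarrow> 'k) rep" where
  "dual_rep scale G V =
     \<lparr>vspace = (\<lambda>i. dual_space scale (vspace V (vstar G i))),
      vmap = (\<lambda>\<alpha> g. fun_scale (dual_sign G \<alpha>)
        (dual_map (vspace V (tail G (astar G \<alpha>))) (vmap V (astar G \<alpha>)) g))\<rparr>"

text \<open>\<open>form V i x y\<close> is the value of the functional \<open>J\<^sub>i x\<close> at \<open>y\<close>, for \<open>x\<close> in \<open>V(i)\<close> and \<open>y\<close> in \<open>V(i\<^sup>*)\<close>.
  The dual of \<open>J\<^sub>i\<close>, composed with the identification of \<open>V(i\<^sup>*)\<close> with its bidual, sends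
  \<open>x\<close> in \<open>V(i\<^sup>*)\<close> to the functional \<open>y \<mapsto> J\<^sub>i y x\<close> on \<open>V(i)\<close>.\<close>

definition is_signed_form :: "('k::field \<Rightarrow> 'b::ab_group_add \<Rightarrow> 'b) \<Rightarrow> ('v, 'a) symm_quiver \<Rightarrow>
    ('v \<Rightarrow> 'b set) \<Rightarrow> ('v \<Rightarrow> 'b \<Rightarrow> 'b \<Rightarrow> 'k) \<Rightarrow> bool" where
  "is_signed_form scale G S J \<longleftrightarrow>
     (\<forall>i\<in>verts G. linear_iso_between scale fun_scale (S i) (dual_space scale (S (vstar G i))) (J i)) \<and>
     (\<forall>i\<in>verts G. vstar G i \<noteq> i \<longrightarrow>
        (\<forall>x\<in>S (vstar G i). \<forall>y\<in>S i. J (vstar G i) x y = J i y x)) \<and>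
     (\<forall>i\<in>verts G. vstar G i = i \<longrightarrow>
        (\<forall>x\<in>S i. \<forall>y\<in>S i. J i y x = of_int (vsign G i) * J i x y))"

definition is_symm_rep :: "('k::field \<Rightarrow> 'b::ab_group_add \<Rightarrow> 'b) \<Rightarrow> ('v, 'a) symm_quiver \<Rightarrow>
    ('v, 'a, 'b, 'k) form_rep \<Rightarrow> bool" where
  "is_symm_rep scale G V \<longleftrightarrow>
     is_rep scale G V \<and>
     is_signed_form scale G (vspace V) (form V) \<and>
     is_rep_iso scale fun_scale G V (dual_rep scale G V) (form V)"

definition nonzero_rep :: "('v, 'a, 'q) pre_digraph_scheme \<Rightarrow> ('v, 'a, 'b::zero, 'r) rep_scheme \<Rightarrow> bool" where
  "nonzero_rep G V \<longleftrightarrow> (\<exists>i\<in>verts G. vspace V i \<noteq> {0})"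

text \<open>Isomorphisms of symmetric representations are required to preserve the forms.\<close>

definition symm_isomorphic :: "('k::field \<Rightarrow> 'b::ab_group_add \<Rightarrow> 'b) \<Rightarrow> ('k \<Rightarrow> 'c::ab_group_add \<Rightarrow> 'c) \<Rightarrow>
    ('v, 'a) symm_quiver \<Rightarrow> ('v, 'a, 'b, 'k) form_rep \<Rightarrow> ('v, 'a, 'c, 'k) form_rep \<Rightarrow> bool" where
  "symm_isomorphic s1 s2 G V V' \<longleftrightarrow>
     (\<exists>f. is_rep_iso s1 s2 G V V' f \<and>
       (\<forall>i\<in>verts G. \<forall>x\<in>vspace V i. \<forall>y\<in>vspace V (vstar G i).
          form V' i (f i x) (f (vstar G i) y) = form V i x y))"

definition symm_dsum :: "('v, 'a) symm_quiver \<Rightarrow> ('v, 'a, 'b, 'k::field) form_rep \<Rightarrow>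
    ('v, 'a, 'c, 'k) form_rep \<Rightarrow> ('v, 'a, 'b \<times> 'c, 'k) form_rep" where
  "symm_dsum G V V' =
     \<lparr>vspace = (\<lambda>i. vspace V i \<times> vspace V' i),
      vmap = (\<lambda>\<alpha>. map_prod (vmap V \<alpha>) (vmap V' \<alpha>)),
      form = (\<lambda>i x y. if y \<in> vspace V (vstar G i) \<times> vspace V' (vstar G i)
        then form V i (fst x) (fst y) + form V' i (snd x) (snd y) else 0)\<rparr>"

text \<open>It suffices to let the two summands range over representations in the same ambient space as
  \<open>V\<close>, because the summands of \<open>V\<close> are isomorphic to subrepresentations of \<open>V\<close>.\<close>

definition indecomposable_symm_rep :: "('k::field \<Rightarrow> 'b::ab_group_add \<Rightarrow> 'b) \<Rightarrow> ('v, 'a) symm_quiver \<Rightarrow>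
    ('v, 'a, 'b, 'k) form_rep \<Rightarrow> bool" where
  "indecomposable_symm_rep scale G V \<longleftrightarrow>
     is_symm_rep scale G V \<and> nonzero_rep G V \<and>
     \<not> (\<exists>V1 V2 :: ('v, 'a, 'b, 'k) form_rep.
          is_symm_rep scale G V1 \<and> nonzero_rep G V1 \<and>
          is_symm_rep scale G V2 \<and> nonzero_rep G V2 \<and>
          symm_isomorphic scale (prod_scale scale scale) G V (symm_dsum G V1 V2))"

definition deletion :: "'a \<Rightarrow> ('v option dbl, 'a option dbl, 'b, 'k) form_rep \<Rightarrow>
    ('v dbl, 'a dbl, 'b, 'k) form_rep" where
  "deletion \<phi> W =
     \<lparr>vspace = (\<lambda>i. vspace W (map_dbl Some i)),
      vmap = (\<lambda>\<alpha>. if \<alpha> = Orig \<phi> then vmap W (Star None) \<circ> vmap W (Orig None)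
        else vmap W (map_dbl Some \<alpha>)),
      form = (\<lambda>i. form W (map_dbl Some i))\<rparr>"

end

theory Submission
  imports Defs
begin

text \<open>
  Write \<open>t\<close> and \<open>h = t\<^sup>*\<close> for the ends of \<open>\<phi>\<close>. A symmetric representation \<open>W\<close> of the enlarged
  quiver consists of its deletion and of a factorization \<open>W(t) \<rightarrow> W(a) \<rightarrow> W(h)\<close> of the map at \<open>\<phi>\<close>, in
  which the forms make the second map adjoint to the first, up to sign. If the first map is
  surjective, the second one is therefore injective, so \<open>W(a)\<close> is the image of the map at
  \<open>\<phi>\<close>. Such a factorization is unique up to unique isomorphism, and the form at \<open>a\<close> is forced by the
  form at \<open>t\<close>. Hence an isomorphism of deletions extends to the vertex \<open>a\<close>
  (\<open>symm_isomorphic_of_deletion\<close>).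

  Conversely, the image of \<open>V(\<phi>)\<close> can be inserted at \<open>a\<close> into every symmetric representation \<open>V\<close> of
  the original quiver (\<open>is_symm_rep_factor_rep\<close>). The bilinear form \<open>J\<^sub>t(x)(V(\<phi>) y)\<close> on \<open>V(t)\<close> is
  \<open>\<sigma>(\<phi>)\<close>-symmetric, because \<open>J\<close> is a morphism, and its radical is the kernel of \<open>V(\<phi>)\<close>. So it
  induces a nondegenerate \<open>\<sigma>(\<phi>)\<close>-symmetric form on the image, as required at a vertex of sign
  \<open>\<sigma>(\<phi>)\<close>. The deletion of this insertion is \<open>V\<close> itself.

  Both constructions commute with direct sums and preserve being nonzero, and surjectivity at \<open>\<psi>\<close>
  passes to direct sums and to summands. So the decompositions of \<open>W\<close> correspond to those of its
  deletion, which is \<open>indecomposable_deletion\<close>.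
\<close>

section \<open>Linear maps between subspaces\<close>

lemma linear_betweenD:
  assumes "linear_between s1 s2 S T f" and "x \<in> S"
  shows "f x \<in> T" and "y \<in> S \<Longrightarrow> f (x + y) = f x + f y" and "f (s1 c x) = s2 c (f x)"
  using assms by (auto simp: linear_between_def)

lemma fin_dim_subspace_closed:
  assumes "vector_space scale" and "fin_dim_subspace scale S"
  shows "x \<in> S \<Longrightarrow> y \<in> S \<Longrightarrow> x + y \<in> S" and "x \<in> S \<Longrightarrow> scale c x \<in> S" and "module.subspace scale S"
proof -
  interpret vector_space scale by fact
  show "module.subspace scale S" using assms(2) by (auto simp: fin_dim_subspace_def)
  then show "x \<in> S \<Longrightarrow> y \<in> S \<Longrightarrow> x + y \<in> S" and "x \<in> S \<Longrightarrow> scale c x \<in> S"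
    by (auto intro: subspace_add subspace_scale)
qed

text \<open>Maps and functionals on a subspace are arbitrary outside it. Replacing them by globally linear
  ones gives access to the linear algebra of the ambient space.\<close>

lemma linear_between_extend:
  assumes "vector_space s1" and "vector_space s2"
    and "module.subspace s1 S" and f: "linear_between s1 s2 S T f"
  obtains F where "Vector_Spaces.linear s1 s2 F" and "\<And>x. x \<in> S \<Longrightarrow> F x = f x"
proof -
  interpret vector_space_pair s1 s2 using assms by (simp add: vector_space_pair_def)
  note S = assms(3)
  obtain B where B: "B \<subseteq> S" "vs1.independent B" "S \<subseteq> vs1.span B"
    using vs1.maximal_independent_subset by metis
  define F where "F = construct B f"
  have F: "Vector_Spaces.linear s1 s2 F"
    unfolding F_def using B(2) by (rule linear_construct)
  have "0 \<in> S" using S by (rule vs1.subspace_0)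
  then have f0: "f 0 = 0"
    using linear_betweenD(2)[OF f, of 0 0] by simp
  have "x \<in> S \<and> F x = f x" if "x \<in> vs1.span B" for x
    using that
  proof (induction rule: vs1.span_induct_alt)
    case base
    then show ?case using f0 \<open>0 \<in> S\<close> linear_0[OF F] by simp
  next
    case (step c b y)
    have "b \<in> S" using step B(1) by blast
    moreover have "F b = f b" unfolding F_def using B(2) step(1) by (rule construct_basis)
    moreover have cb: "s1 c b \<in> S" using S \<open>b \<in> S\<close> by (rule vs1.subspace_scale)
    moreover have "s1 c b + y \<in> S" using S cb step(2) by (auto intro: vs1.subspace_add)
    ultimately show ?case
      using step(2) linear_betweenD(2,3)[OF f] by (simp add: linear_add[OF F] linear_scale[OF F])
  qed
  with F B(3) show ?thesis by (blast intro: that)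
qed

lemma fin_dim_subspace_image:
  assumes vs: "vector_space s1" "vector_space s2"
    and "fin_dim_subspace s1 S" and f: "linear_between s1 s2 S T f"
  shows "fin_dim_subspace s2 (f ` S)"
proof -
  interpret vector_space_pair s1 s2 using vs by (simp add: vector_space_pair_def)
  obtain B where B: "finite B" "S = vs1.span B"
    using assms(3) by (auto simp: fin_dim_subspace_def)
  obtain F where F: "Vector_Spaces.linear s1 s2 F" "\<And>x. x \<in> S \<Longrightarrow> F x = f x"
    using linear_between_extend[OF vs fin_dim_subspace_closed(3)[OF vs(1) assms(3)] f] by blast
  have "f ` S = F ` S" using F(2) by simp
  also have "\<dots> = vs2.span (F ` B)" unfolding B(2) using F(1) by (rule linear_span_image[symmetric])
  finally show ?thesis using B(1) by (auto simp: fin_dim_subspace_def)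
qed

lemma functional_extend:
  assumes vs: "vector_space scale" and S: "module.subspace scale S" and T: "module.subspace scale T"
    and "S \<subseteq> T" and g: "g \<in> dual_space scale S"
  obtains g' where "g' \<in> dual_space scale T" and "\<And>x. x \<in> S \<Longrightarrow> g' x = g x"
proof -
  interpret vector_space scale by fact
  have vsk: "vector_space ((*) :: 'a \<Rightarrow> 'a \<Rightarrow> 'a)" by (unfold_locales) (auto simp: algebra_simps)
  interpret vector_space_pair scale "(*)" using vs vsk by (simp add: vector_space_pair_def)
  obtain F where F: "Vector_Spaces.linear scale (*) F" "\<And>x. x \<in> S \<Longrightarrow> F x = g x"
    using linear_between_extend[OF vs vsk S] g by (auto simp: dual_space_def)
  have F_lin: "F (x + y) = F x + F y" "F (scale c x) = c * F x" for x y c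
    using linear_add[OF F(1)] linear_scale[OF F(1)] by auto
  show ?thesis
  proof
    show "(\<lambda>x. if x \<in> T then F x else 0) \<in> dual_space scale T"
      using T F_lin by (auto simp: dual_space_def linear_between_def subspace_add subspace_scale)
    show "(if x \<in> T then F x else 0) = g x" if "x \<in> S" for x
      using F(2) that \<open>S \<subseteq> T\<close> by auto
  qed
qed

section \<open>Symmetric representations\<close>

text \<open>The dual map vanishes outside the space at the tail of the dual arrow, which is why the
  compatibility with an arrow is an identity for all \<open>y\<close>.\<close>

lemma is_symm_rep_iff:
  "is_symm_rep scale G V \<longleftrightarrow>
     is_rep scale G V \<and> is_signed_form scale G (vspace V) (form V) \<and>
     (\<forall>\<alpha>\<in>arcs G. \<forall>x\<in>vspace V (tail G \<alpha>). \<forall>y.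
        form V (head G \<alpha>) (vmap V \<alpha> x) y = dual_sign G \<alpha> *
          (if y \<in> vspace V (tail G (astar G \<alpha>)) then form V (tail G \<alpha>) x (vmap V (astar G \<alpha>) y) else 0))"
  unfolding is_symm_rep_def is_rep_iso_def is_signed_form_def dual_rep_def
  by (auto simp: fun_eq_iff fun_scale_def dual_map_def)

section \<open>The symmetric quiver after the insertion\<close>

locale signed_arrow_insertion =
  fixes Q :: "('v, 'a) signed_quiver" and \<phi> :: 'a
  assumes quiver: "signed_quiver Q"
    and arrow: "\<phi> \<in> arcs Q"
    and signed: "asign Q \<phi> \<noteq> 0"
    and nonloop: "tail Q \<phi> \<noteq> head Q \<phi>"
begin

abbreviation "G \<equiv> assoc_symm_quiver Q"
abbreviation "H \<equiv> assoc_symm_quiver (insertion \<phi> Q)"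
abbreviation "emb \<equiv> map_dbl Some"
abbreviation "t \<equiv> Orig (tail Q \<phi>)"
abbreviation "h \<equiv> Orig (head Q \<phi>)"
abbreviation (input) "a \<equiv> Orig None"
abbreviation "\<epsilon> \<equiv> of_int (asign Q \<phi>)"

lemma twin_eqI:
  assumes "{i, j} \<in> twins Q" "i \<noteq> j"
  shows "twin Q i = j" "twin (insertion \<phi> Q) (Some i) = Some j"
proof -
  have uniq: "k = j" if "k \<noteq> i" "{i, k} \<in> twins Q" for k
    using signed_quiver.twins_disjoint[OF quiver] that assms
    by (fastforce simp: pairwise_def disjnt_def doubleton_eq_iff)
  show "twin Q i = j"
    unfolding twin_def using assms uniq by (blast intro!: the_equality)
  have "{Some i, k} \<in> (`) Some ` twins Q \<longleftrightarrow> (\<exists>l. k = Some l \<and> {i, l} \<in> twins Q)" for k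
  proof
    assume "{Some i, k} \<in> (`) Some ` twins Q"
    then obtain T where T: "T \<in> twins Q" "{Some i, k} = Some ` T" by blast
    then obtain l where "k = Some l" by blast
    with T(2) have "Some ` {i, l} = Some ` T" by simp
    then have "{i, l} = T" by (subst (asm) inj_image_eq_iff) simp_all
    with T \<open>k = Some l\<close> show "\<exists>l. k = Some l \<and> {i, l} \<in> twins Q" by blast
  qed (force intro: rev_image_eqI)
  then show "twin (insertion \<phi> Q) (Some i) = Some j"
    unfolding twin_def insertion_def using assms uniq by (auto intro!: the_equality)
qed

lemma twin_insertion:
  assumes "i \<in> \<Union> (twins Q)"
  shows "twin (insertion \<phi> Q) (Some i) = Some (twin Q i)"
proof -
  obtain T where T: "T \<in> twins Q" "i \<in> T" using assms by blast
  with signed_quiver.twins_pairs[OF quiver] have "card T = 2" by blast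
  with T(2) obtain j where "T = {i, j}" "i \<noteq> j" by (auto simp: card_2_iff)
  with T(1) twin_eqI[of i j] show ?thesis by simp
qed

text \<open>Since the arrow is signed, its head is the twin of its tail. This makes \<open>V(\<phi>)\<close> a map from
  \<open>V(t)\<close> to \<open>V(t\<^sup>*)\<close>, hence a bilinear form on \<open>V(t)\<close>.\<close>

lemma ends_twins: "{tail Q \<phi>, head Q \<phi>} \<in> twins Q"
  using signed_quiver.nonloop_signed_iff[OF quiver arrow nonloop] signed by simp

lemma asign_cases: "asign Q \<phi> = 1 \<or> asign Q \<phi> = -1"
  using signed_quiver.asign_range[OF quiver arrow] signed by auto

lemma sign_sq: "\<epsilon> * (\<epsilon> * x) = (x :: 'k::field)"
  using asign_cases by auto

lemma vsign_ends: "vsign Q (tail Q \<phi>) = 0" "vsign Q (head Q \<phi>) = 0"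
  using signed_quiver.twins_unsigned[OF quiver] ends_twins by blast+

lemma star_ends:
  "vstar G t = h" "vstar G h = t"
  using ends_twins twin_eqI(1)[of "tail Q \<phi>" "head Q \<phi>"] twin_eqI(1)[of "head Q \<phi>" "tail Q \<phi>"] nonloop
  by (auto simp: assoc_symm_quiver_def insert_commute)

lemma emb_inj [simp]: "emb x = emb y \<longleftrightarrow> x = y"
  by (metis dbl.inj_map inj_Some injD)

lemma emb_neq [simp]: "emb x \<noteq> Orig None" "emb x \<noteq> Star None" "Orig None \<noteq> emb x" "Star None \<noteq> emb x"
  by (cases x; simp)+

lemma the_emb [simp]: "map_dbl the (emb x) = x"
  by (cases x) auto

lemma verts_H: "verts H = insert a (emb ` verts G)"
proof -
  have "Some i \<in> \<Union> (twins (insertion \<phi> Q)) \<longleftrightarrow> i \<in> \<Union> (twins Q)" for i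
    by (auto simp: insertion_def)
  then have "{j \<in> verts (insertion \<phi> Q). vsign (insertion \<phi> Q) j = 0 \<and> j \<notin> \<Union> (twins (insertion \<phi> Q))}
      = Some ` {j \<in> verts Q. vsign Q j = 0 \<and> j \<notin> \<Union> (twins Q)}"
    using signed by (auto simp: insertion_def image_iff) blast
  moreover have "verts (insertion \<phi> Q) = insert None (Some ` verts Q)" by (simp add: insertion_def)
  ultimately show ?thesis
    by (simp add: assoc_symm_quiver_def image_Un image_image)
qed

lemma arcs_H: "arcs H = insert (Orig None) (insert (Star None) (emb ` (arcs G - {Orig \<phi>})))"
proof -
  have "{j \<in> arcs (insertion \<phi> Q). asign (insertion \<phi> Q) j = 0}
      = insert None (Some ` {j \<in> arcs Q. asign Q j = 0})"
    using signed by (auto simp: insertion_def)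
  moreover have "arcs (insertion \<phi> Q) = insert None (Some ` (arcs Q - {\<phi>}))" by (simp add: insertion_def)
  moreover have "arcs G - {Orig \<phi>} = Orig ` (arcs Q - {\<phi>}) \<union> Star ` {\<alpha> \<in> arcs Q. asign Q \<alpha> = 0}"
    by (auto simp: assoc_symm_quiver_def)
  ultimately show ?thesis
    by (simp add: assoc_symm_quiver_def image_Un image_image insert_commute)
qed

lemma in_G: "t \<in> verts G" "h \<in> verts G" "Orig \<phi> \<in> arcs G"
proof -
  have "{tail Q \<phi>, head Q \<phi>} \<subseteq> verts Q"
    using signed_quiver.twins_pairs[OF quiver ends_twins] by blast
  then show "t \<in> verts G" "h \<in> verts G" "Orig \<phi> \<in> arcs G"
    using arrow by (auto simp: assoc_symm_quiver_def)
qed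

lemma vstar_emb [simp]: "vstar H (emb i) = emb (vstar G i)"
proof (cases i)
  case (Orig j)
  have "Some j \<in> \<Union> (twins (insertion \<phi> Q)) \<longleftrightarrow> j \<in> \<Union> (twins Q)"
    by (auto simp: insertion_def)
  moreover have "vsign (insertion \<phi> Q) (Some j) = vsign Q j" by (simp add: insertion_def)
  ultimately show ?thesis
    using twin_insertion[of j] Orig by (simp add: assoc_symm_quiver_def)
qed (simp add: assoc_symm_quiver_def)

lemma vstar_new [simp]: "vstar H a = a"
  using signed by (auto simp: assoc_symm_quiver_def insertion_def)

lemma vsign_H [simp]: "vsign H (emb i) = vsign G i" "vsign H a = asign Q \<phi>"
  by (cases i) (auto simp: assoc_symm_quiver_def insertion_def)

lemma asign_emb [simp]: "asign H (emb \<alpha>) = asign G \<alpha>"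
  by (cases \<alpha>) (auto simp: assoc_symm_quiver_def insertion_def)

lemma astar_emb [simp]: "astar H (emb \<alpha>) = emb (astar G \<alpha>)"
  by (cases \<alpha>) (auto simp: assoc_symm_quiver_def insertion_def)

lemma ends_emb [simp]: "tail H (emb \<alpha>) = emb (tail G \<alpha>)" "head H (emb \<alpha>) = emb (head G \<alpha>)"
proof -
  have "star_vert (insertion \<phi> Q) (Orig (Some i)) = emb (star_vert Q (Orig i))" for i
    using vstar_emb[of "Orig i"] by (simp add: assoc_symm_quiver_def)
  then show "tail H (emb \<alpha>) = emb (tail G \<alpha>)" "head H (emb \<alpha>) = emb (head G \<alpha>)"
    by (cases \<alpha>; simp add: assoc_symm_quiver_def insertion_def del: star_vert.simps)+
qed

lemma dual_sign_emb [simp]: "dual_sign H (emb \<alpha>) = dual_sign G \<alpha>"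
  by (simp add: dual_sign_def)

lemma phi_G: "tail G (Orig \<phi>) = t" "head G (Orig \<phi>) = h" "astar G (Orig \<phi>) = Orig \<phi>"
  "dual_sign G (Orig \<phi>) = (\<epsilon> :: 'k::field)"
  using signed asign_cases vsign_ends by (auto simp: assoc_symm_quiver_def dual_sign_def)

lemma psi_H [simp]: "tail H (Orig None) = emb t" "head H (Orig None) = a" "astar H (Orig None) = Star None"
  "dual_sign H (Orig None) = (\<epsilon> :: 'k::field)"
  using asign_cases by (auto simp: assoc_symm_quiver_def dual_sign_def insertion_def)

lemma psi_star_H [simp]: "tail H (Star None) = a" "head H (Star None) = emb h" "astar H (Star None) = Orig None"
  "dual_sign H (Star None) = (1 :: 'k::field)"
proof -
  have "star_vert (insertion \<phi> Q) (Orig None) = a"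
    using vstar_new by (simp add: assoc_symm_quiver_def)
  moreover have "star_vert (insertion \<phi> Q) (Orig (Some (tail Q \<phi>))) = emb h"
    using vstar_emb[of t] star_ends by (simp add: assoc_symm_quiver_def)
  ultimately show "tail H (Star None) = a" and hd: "head H (Star None) = emb h"
    by (simp_all add: assoc_symm_quiver_def insertion_def del: star_vert.simps)
  show "astar H (Star None) = Orig None" by (simp add: assoc_symm_quiver_def)
  have "vsign H (emb h) = 0" using vsign_ends by (simp add: assoc_symm_quiver_def insertion_def)
  moreover have "asign H (Star None) = 0" by (simp add: assoc_symm_quiver_def)
  ultimately show "dual_sign H (Star None) = (1 :: 'k::field)" by (simp add: dual_sign_def hd)
qed

lemma astar_neq_phi: "\<alpha> \<in> arcs G \<Longrightarrow> \<alpha> \<noteq> Orig \<phi> \<Longrightarrow> astar G \<alpha> \<noteq> Orig \<phi>"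
  using signed by (cases \<alpha>) (auto simp: assoc_symm_quiver_def)

section \<open>Restriction to the old vertices and arrows\<close>

abbreviation "t' \<equiv> Orig (Some (tail Q \<phi>))"
abbreviation "h' \<equiv> Orig (Some (head Q \<phi>))"

lemma star_ends_H: "vstar H t' = h'" "vstar H h' = t'"
  using vstar_emb[of t] vstar_emb[of h] star_ends by simp_all

lemma in_H: "t' \<in> verts H" "a \<in> verts H"
  using in_G(1) by (auto simp: verts_H image_iff) (metis dbl.map(1))

lemma deletion_simps:
  "vspace (deletion \<phi> W) i = vspace W (emb i)"
  "form (deletion \<phi> W) i = form W (emb i)"
  "\<alpha> \<noteq> Orig \<phi> \<Longrightarrow> vmap (deletion \<phi> W) \<alpha> = vmap W (emb \<alpha>)"
  "vmap (deletion \<phi> W) (Orig \<phi>) x = vmap W (Star None) (vmap W (Orig None) x)"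
  by (auto simp: deletion_def)

lemma ball_H:
  "(\<forall>i\<in>verts H. P i) \<longleftrightarrow> P a \<and> (\<forall>i\<in>verts G. P (emb i))"
  "(\<forall>\<alpha>\<in>arcs H. R \<alpha>) \<longleftrightarrow> R (Orig None) \<and> R (Star None) \<and> (\<forall>\<alpha>\<in>arcs G - {Orig \<phi>}. R (emb \<alpha>))"
  unfolding verts_H arcs_H by simp_all

lemma is_rep_H_iff:
  "is_rep scale H W \<longleftrightarrow>
     (\<forall>i\<in>verts G. fin_dim_subspace scale (vspace W (emb i))) \<and> fin_dim_subspace scale (vspace W a) \<and>
     (\<forall>\<alpha>\<in>arcs G - {Orig \<phi>}. linear_between scale scale
        (vspace W (emb (tail G \<alpha>))) (vspace W (emb (head G \<alpha>))) (vmap W (emb \<alpha>))) \<and>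
     linear_between scale scale (vspace W t') (vspace W a) (vmap W (Orig None)) \<and>
     linear_between scale scale (vspace W a) (vspace W h') (vmap W (Star None))"
  unfolding is_rep_def ball_H by (simp add: conj_ac)

lemma is_signed_form_H_iff:
  "is_signed_form scale H (vspace W) (form W) \<longleftrightarrow>
     is_signed_form scale G (vspace (deletion \<phi> W)) (form (deletion \<phi> W)) \<and>
     linear_iso_between scale fun_scale (vspace W a) (dual_space scale (vspace W a)) (form W a) \<and>
     (\<forall>x\<in>vspace W a. \<forall>y\<in>vspace W a. form W a y x = \<epsilon> * form W a x y)"
  unfolding is_signed_form_def deletion_simps ball_H vstar_emb vstar_new vsign_H emb_inj by blast

text \<open>The last two conjuncts say that the maps at \<open>\<psi>\<close> and \<open>\<psi>\<^sup>*\<close> are adjoint up to sign; the arrow \<open>\<psi>\<close>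
  carries the sign of its head \<open>a\<close>, whereas the head of \<open>\<psi>\<^sup>*\<close> is unsigned.\<close>

lemma is_symm_rep_H_iff:
  "is_symm_rep scale H W \<longleftrightarrow>
     is_rep scale H W \<and> is_signed_form scale G (vspace (deletion \<phi> W)) (form (deletion \<phi> W)) \<and>
     linear_iso_between scale fun_scale (vspace W a) (dual_space scale (vspace W a)) (form W a) \<and>
     (\<forall>x\<in>vspace W a. \<forall>y\<in>vspace W a. form W a y x = \<epsilon> * form W a x y) \<and>
     (\<forall>\<alpha>\<in>arcs G - {Orig \<phi>}. \<forall>x\<in>vspace W (emb (tail G \<alpha>)). \<forall>y.
        form W (emb (head G \<alpha>)) (vmap W (emb \<alpha>) x) y = dual_sign G \<alpha> *
          (if y \<in> vspace W (emb (tail G (astar G \<alpha>)))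
           then form W (emb (tail G \<alpha>)) x (vmap W (emb (astar G \<alpha>)) y) else 0)) \<and>
     (\<forall>x\<in>vspace W t'. \<forall>v. form W a (vmap W (Orig None) x) v =
        \<epsilon> * (if v \<in> vspace W a then form W t' x (vmap W (Star None) v) else 0)) \<and>
     (\<forall>u\<in>vspace W a. \<forall>y. form W h' (vmap W (Star None) u) y =
        (if y \<in> vspace W t' then form W a u (vmap W (Orig None) y) else 0))"
  unfolding is_symm_rep_iff is_signed_form_H_iff ball_H by (simp add: conj_ac)

lemma phi_arrow_split:
  "(\<forall>\<alpha>\<in>arcs G. P \<alpha>) \<longleftrightarrow> P (Orig \<phi>) \<and> (\<forall>\<alpha>\<in>arcs G - {Orig \<phi>}. P \<alpha>)"
  using in_G by auto

text \<open>Moving the composite \<open>\<psi>\<^sup>*\<psi>\<close> from one argument of the form to the other goes through the form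
  at \<open>a\<close>: the passage across \<open>\<psi>\<^sup>*\<close> contributes no sign and the one across \<open>\<psi>\<close> the sign of \<open>a\<close>,
  together the sign demanded at \<open>\<phi>\<close>.\<close>

lemma is_symm_rep_deletion:
  assumes W: "is_symm_rep scale H W"
  shows "is_symm_rep scale G (deletion \<phi> W)"
proof -
  have rep: "is_rep scale H W" using W by (simp add: is_symm_rep_H_iff)
  have psi: "vmap W (Orig None) x \<in> vspace W a" if "x \<in> vspace W t'" for x
    using rep that linear_betweenD(1) unfolding is_rep_H_iff by blast
  have "linear_between scale scale (vspace W t') (vspace W h') (vmap W (Star None) \<circ> vmap W (Orig None))"
    using rep by (simp add: is_rep_H_iff linear_between_def)
  then have "is_rep scale G (deletion \<phi> W)"
    using rep unfolding is_rep_def[of _ G]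
    by (auto simp: deletion_simps is_rep_H_iff deletion_def phi_G)
  moreover have "form W h' (vmap W (Star None) (vmap W (Orig None) x)) y = \<epsilon> *
      (if y \<in> vspace W t' then form W t' x (vmap W (Star None) (vmap W (Orig None) y)) else 0)"
    if x: "x \<in> vspace W t'" for x y
  proof -
    have "form W h' (vmap W (Star None) (vmap W (Orig None) x)) y =
        (if y \<in> vspace W t' then form W a (vmap W (Orig None) x) (vmap W (Orig None) y) else 0)"
      using W psi[OF x] unfolding is_symm_rep_H_iff by blast
    moreover have "form W a (vmap W (Orig None) x) (vmap W (Orig None) y) =
        \<epsilon> * form W t' x (vmap W (Star None) (vmap W (Orig None) y))" if y: "y \<in> vspace W t'"
    proof -
      have "form W a (vmap W (Orig None) x) v =
          \<epsilon> * (if v \<in> vspace W a then form W t' x (vmap W (Star None) v) else 0)" for v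
        using W x unfolding is_symm_rep_H_iff by blast
      then show ?thesis using psi[OF y] by simp
    qed
    ultimately show ?thesis by simp
  qed
  moreover have "form W (emb (head G \<alpha>)) (vmap W (emb \<alpha>) x) y = dual_sign G \<alpha> *
      (if y \<in> vspace W (emb (tail G (astar G \<alpha>)))
       then form W (emb (tail G \<alpha>)) x (vmap W (emb (astar G \<alpha>)) y) else 0)"
    if "\<alpha> \<in> arcs G" "\<alpha> \<noteq> Orig \<phi>" "x \<in> vspace W (emb (tail G \<alpha>))" for \<alpha> x y
    using W that unfolding is_symm_rep_H_iff by blast
  moreover have "is_signed_form scale G (vspace (deletion \<phi> W)) (form (deletion \<phi> W))"
    using W by (simp add: is_symm_rep_H_iff)
  ultimately show ?thesis
    unfolding is_symm_rep_iff[of _ G] by (simp add: phi_arrow_split deletion_simps astar_neq_phi phi_G)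
qed

section \<open>Insertion of the image\<close>

definition im :: "('v dbl, 'a dbl, 'b, 'k) form_rep \<Rightarrow> 'b set" where
  "im V = vmap V (Orig \<phi>) ` vspace V t"

text \<open>The form induced on the image by the bilinear form \<open>J\<^sub>t(x)(V(\<phi>) y)\<close> on \<open>V(t)\<close>: at \<open>V(\<phi>) x\<close> and
  \<open>V(\<phi>) y\<close> it is that value times \<open>\<sigma>(\<phi>)\<close>. The factor is forced by the sign attached to \<open>\<psi>\<close>.\<close>

definition im_form :: "('v dbl, 'a dbl, 'b, 'k::field) form_rep \<Rightarrow> 'b \<Rightarrow> 'b \<Rightarrow> 'k" where
  "im_form V u v =
     (if v \<in> im V then \<epsilon> * form V t (inv_into (vspace V t) (vmap V (Orig \<phi>)) u) v else 0)"

definition factor_rep :: "('v dbl, 'a dbl, 'b, 'k::field) form_rep \<Rightarrow>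
    ('v option dbl, 'a option dbl, 'b, 'k) form_rep" where
  "factor_rep V =
     \<lparr>vspace = (\<lambda>i. if i = a then im V else vspace V (map_dbl the i)),
      vmap = (\<lambda>\<alpha>. if \<alpha> = Orig None then vmap V (Orig \<phi>)
        else if \<alpha> = Star None then id else vmap V (map_dbl the \<alpha>)),
      form = (\<lambda>i. if i = a then im_form V else form V (map_dbl the i))\<rparr>"

lemma factor_rep_simps [simp]:
  "vspace (factor_rep V) a = im V" "vspace (factor_rep V) (emb i) = vspace V i"
  "vspace (factor_rep V) (Orig (Some k)) = vspace V (Orig k)"
  "form (factor_rep V) a = im_form V" "form (factor_rep V) (emb i) = form V i"
  "form (factor_rep V) (Orig (Some k)) = form V (Orig k)"
  "vmap (factor_rep V) (Orig None) = vmap V (Orig \<phi>)" "vmap (factor_rep V) (Star None) = id"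
  "vmap (factor_rep V) (emb \<alpha>) = vmap V \<alpha>"
  by (simp_all add: factor_rep_def)

lemma deletion_factor_rep [simp]: "deletion \<phi> (factor_rep V) = V"
  by (simp add: deletion_def fun_eq_iff cong: if_cong)

lemma factor_rep_surj:
  "vmap (factor_rep V) (Orig None) ` vspace (factor_rep V) t' = vspace (factor_rep V) a"
  by (simp add: im_def)

text \<open>The map at \<open>\<phi>\<close> is self-adjoint up to the sign \<open>\<epsilon>\<close>. This one identity makes the form on the
  image independent of the chosen preimage, \<open>\<epsilon>\<close>-symmetric, and compatible with the inclusion of
  the image into \<open>V(h)\<close>. By that compatibility \<open>J\<^sub>a\<close> is injective, as \<open>J\<^sub>h\<close> is.\<close>

lemma is_symm_rep_factor_rep:
  assumes vs: "vector_space scale" and V: "is_symm_rep scale G V"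
  shows "is_symm_rep scale H (factor_rep V)"
proof -
  let ?\<phi> = "vmap V (Orig \<phi>)" and ?T = "vspace V t" and ?U = "vspace V h"
  let ?J = "form V t" and ?J' = "form V h"
  have rep: "is_rep scale G V" and sf: "is_signed_form scale G (vspace V) (form V)"
    using V by (auto simp: is_symm_rep_iff)
  have lin: "linear_between scale scale ?T ?U ?\<phi>"
    using rep in_G unfolding is_rep_def by (metis phi_G(1,2))
  have fdT: "fin_dim_subspace scale ?T" and fdU: "fin_dim_subspace scale ?U"
    using rep in_G unfolding is_rep_def by auto
  have fdim: "fin_dim_subspace scale (im V)"
    unfolding im_def using vs vs fdT lin by (rule fin_dim_subspace_image)
  have im_U: "im V \<subseteq> ?U"
    using linear_betweenD(1)[OF lin] by (auto simp: im_def)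
  note closT = fin_dim_subspace_closed(1,2)[OF vs fdT]
  have J: "linear_iso_between scale fun_scale ?T (dual_space scale ?U) ?J"
    and J': "linear_iso_between scale fun_scale ?U (dual_space scale ?T) ?J'"
    using sf in_G star_ends by (auto simp: is_signed_form_def)
  have J_swap: "?J' w y = ?J y w" if "w \<in> ?U" "y \<in> ?T" for w y
    using sf in_G star_ends nonloop that unfolding is_signed_form_def by (metis dbl.inject(1))
  have adj: "?J' (?\<phi> x) y = \<epsilon> * (if y \<in> ?T then ?J x (?\<phi> y) else 0)" if "x \<in> ?T" for x y
    using V in_G that unfolding is_symm_rep_iff by (metis phi_G)
  (* Applying adj moves phi onto the first argument, so only phi x matters. *)
  have imf: "im_form V (?\<phi> x) v = (if v \<in> im V then \<epsilon> * ?J x v else 0)" if x: "x \<in> ?T" for x v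
  proof (cases "v \<in> im V")
    case True
    then obtain y where y: "y \<in> ?T" "v = ?\<phi> y" by (auto simp: im_def)
    let ?x = "inv_into ?T ?\<phi> (?\<phi> x)"
    have x': "?x \<in> ?T" "?\<phi> ?x = ?\<phi> x"
      using x by (auto intro: inv_into_into f_inv_into_f)
    have "\<epsilon> * ?J ?x v = ?J' (?\<phi> ?x) y" using adj[OF x'(1), of y] y by simp
    also have "\<dots> = \<epsilon> * ?J x v" using adj[OF x, of y] y x'(2) by simp
    finally show ?thesis using True by (simp add: im_form_def)
  qed (simp add: im_form_def)
  have J_dual: "?J x \<in> dual_space scale ?U" if "x \<in> ?T" for x
    using J that by (auto simp: linear_iso_between_def linear_between_def)
  have J_lin: "linear_between scale fun_scale ?T (dual_space scale ?U) ?J"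
    using J by (simp add: linear_iso_between_def)
  have J_scale: "?J (scale c x) v = c * ?J x v" if "x \<in> ?T" for c x v
    using linear_betweenD(3)[OF J_lin that] by (simp add: fun_scale_def)
  have J_add: "?J (x + y) v = ?J x v + ?J y v" if "x \<in> ?T" "y \<in> ?T" for x y v
    using linear_betweenD(2)[OF J_lin that] by simp
  have adj': "?J' u y = (if y \<in> ?T then im_form V u (?\<phi> y) else 0)" if u: "u \<in> im V" for u y
  proof -
    obtain x where "x \<in> ?T" "u = ?\<phi> x" using u by (auto simp: im_def)
    then show ?thesis using adj imf by (auto simp: im_def)
  qed
  have im_lin: "linear_between scale fun_scale (im V) (dual_space scale (im V)) (im_form V)"
    unfolding linear_between_def
  proof (intro conjI ballI allI)
    fix u assume "u \<in> im V"
    then obtain x where x: "x \<in> ?T" "u = ?\<phi> x" by (auto simp: im_def)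
    have clos: "v + w \<in> im V" "scale c v \<in> im V" if "v \<in> im V" "w \<in> im V" for v w c
      using fin_dim_subspace_closed(1,2)[OF vs fdim] that by auto
    have "?J x (v + w) = ?J x v + ?J x w" "?J x (scale c v) = c * ?J x v"
      if "v \<in> im V" "w \<in> im V" for v w c
      using J_dual[OF x(1)] that im_U unfolding dual_space_def linear_between_def by blast+
    then show "im_form V u \<in> dual_space scale (im V)"
      unfolding dual_space_def linear_between_def x(2) using clos
      by (simp add: imf[OF x(1)] algebra_simps)
    show "im_form V (scale c u) = fun_scale c (im_form V u)" for c
      unfolding x(2) linear_betweenD(3)[OF lin x(1), symmetric]
      by (simp add: fun_eq_iff imf[OF closT(2)[OF x(1)]] imf[OF x(1)] J_scale[OF x(1)] fun_scale_def)
    fix v assume "v \<in> im V"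
    then obtain y where y: "y \<in> ?T" "v = ?\<phi> y" by (auto simp: im_def)
    show "im_form V (u + v) = im_form V u + im_form V v"
      unfolding x(2) y(2) linear_betweenD(2)[OF lin x(1) y(1), symmetric]
      by (simp add: fun_eq_iff imf[OF closT(1)[OF x(1) y(1)]] imf[OF x(1)] imf[OF y(1)]
          J_add[OF x(1) y(1)] distrib_left)
  qed
  have im_inj: "inj_on (im_form V) (im V)"
  proof (rule inj_onI)
    fix u u' assume u: "u \<in> im V" "u' \<in> im V" "im_form V u = im_form V u'"
    then have "?J' u = ?J' u'" using adj' by (auto simp: fun_eq_iff)
    then show "u = u'" using J' u im_U
      by (auto simp: linear_iso_between_def bij_betw_def inj_on_def)
  qed
  (* A functional on the image extends to V(h), and every functional on V(h) is J_t(x) for some x;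
     the factor epsilon undoes the one in im_form. *)
  have im_onto: "\<exists>u\<in>im V. im_form V u = g" if g: "g \<in> dual_space scale (im V)" for g
  proof -
    obtain g' where g': "g' \<in> dual_space scale ?U" "\<And>v. v \<in> im V \<Longrightarrow> g' v = g v"
      using functional_extend[OF vs fin_dim_subspace_closed(3)[OF vs fdim]
          fin_dim_subspace_closed(3)[OF vs fdU] im_U g] by blast
    then obtain x where x: "x \<in> ?T" "g' = ?J x"
      using J by (auto simp: linear_iso_between_def bij_betw_def)
    let ?x = "scale \<epsilon> x"
    have x': "?x \<in> ?T" using closT(2) x(1) .
    have "im_form V (?\<phi> ?x) v = g v" for v
    proof (cases "v \<in> im V")
      case True
      then show ?thesis using g'(2)[OF True] x(2) by (simp add: imf[OF x'] J_scale[OF x(1)] sign_sq)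
    next
      case False
      then show ?thesis using g by (simp add: imf[OF x'] dual_space_def)
    qed
    then have "im_form V (?\<phi> ?x) = g" ..
    then show ?thesis using x' by (auto simp: im_def)
  qed
  have "bij_betw (im_form V) (im V) (dual_space scale (im V))"
    unfolding bij_betw_def using im_inj im_onto im_lin by (auto simp: linear_between_def)
  then have im_iso: "linear_iso_between scale fun_scale (im V) (dual_space scale (im V)) (im_form V)"
    using im_lin by (simp add: linear_iso_between_def)
  have im_symm: "im_form V v u = \<epsilon> * im_form V u v" if uv: "u \<in> im V" "v \<in> im V" for u v
  proof -
    obtain x y where xy: "x \<in> ?T" "u = ?\<phi> x" "y \<in> ?T" "v = ?\<phi> y" using uv by (auto simp: im_def)
    have "im_form V v u = \<epsilon> * ?J y u" using imf[OF xy(3)] xy uv by simp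
    also have "?J y u = ?J' u y" using J_swap xy(3) uv im_U by auto
    also have "\<dots> = im_form V u v" using adj'[OF uv(1)] xy by simp
    finally show ?thesis .
  qed
  have rep': "is_rep scale H (factor_rep V)"
    using rep lin fdim im_U unfolding is_rep_H_iff by (auto simp: is_rep_def linear_between_def im_def)
  have psi: "im_form V (?\<phi> x) v = \<epsilon> * (if v \<in> im V then ?J x v else 0)" if "x \<in> ?T" for x v
    using imf[OF that] by simp
  show ?thesis
    unfolding is_symm_rep_H_iff deletion_factor_rep factor_rep_simps id_apply
  proof (intro conjI ballI allI)
    show "form V (head G \<alpha>) (vmap V \<alpha> x) y = dual_sign G \<alpha> *
        (if y \<in> vspace V (tail G (astar G \<alpha>)) then form V (tail G \<alpha>) x (vmap V (astar G \<alpha>) y) else 0)"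
      if "\<alpha> \<in> arcs G - {Orig \<phi>}" "x \<in> vspace V (tail G \<alpha>)" for \<alpha> x y
      using V that unfolding is_symm_rep_iff by blast
  qed (fact rep' sf im_iso im_symm psi adj')+
qed

section \<open>Uniqueness of the factorization\<close>

text \<open>This is the part of a symmetric representation with surjective \<open>\<psi>\<close> that determines the space
  and the form at \<open>a\<close>. It asks for less than a symmetric representation, so that a direct sum need
  not be shown to be one.\<close>

definition epi_mono ::
  "('k \<Rightarrow> 'b::ab_group_add \<Rightarrow> 'b) \<Rightarrow> ('v option dbl, 'a option dbl, 'b, 'k::field) form_rep \<Rightarrow> bool" where
  "epi_mono scale W \<longleftrightarrow>
     linear_between scale scale (vspace W t') (vspace W a) (vmap W (Orig None)) \<and>
     vmap W (Orig None) ` vspace W t' = vspace W a \<and>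
     inj_on (vmap W (Star None)) (vspace W a) \<and>
     (\<forall>x\<in>vspace W t'. \<forall>v\<in>vspace W a.
        form W a (vmap W (Orig None) x) v = \<epsilon> * form W t' x (vmap W (Star None) v))"

text \<open>Because \<open>\<psi>\<^sup>*\<close> is adjoint to the surjective \<open>\<psi>\<close>, two vectors with the same image under \<open>\<psi>\<^sup>*\<close>
  pair equally with all of \<open>W(a)\<close>, and the form at \<open>a\<close> is nondegenerate.\<close>

lemma epi_mono_if_surj:
  assumes W: "is_symm_rep scale H W"
    and surj: "vmap W (Orig None) ` vspace W t' = vspace W a"
  shows "epi_mono scale W"
proof -
  have psi: "form W a (vmap W (Orig None) x) v =
      \<epsilon> * (if v \<in> vspace W a then form W t' x (vmap W (Star None) v) else 0)"
    if "x \<in> vspace W t'" for x v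
    using W that unfolding is_symm_rep_H_iff by blast
  have psi': "form W h' (vmap W (Star None) u) y =
      (if y \<in> vspace W t' then form W a u (vmap W (Orig None) y) else 0)" if "u \<in> vspace W a" for u y
    using W that unfolding is_symm_rep_H_iff by blast
  have iso: "linear_iso_between scale fun_scale (vspace W a) (dual_space scale (vspace W a)) (form W a)"
    using W by (simp add: is_symm_rep_H_iff)
  have vanish: "form W a u v = 0" if "u \<in> vspace W a" "v \<notin> vspace W a" for u v
    using iso that by (auto simp: linear_iso_between_def linear_between_def dual_space_def)
  have "inj_on (vmap W (Star None)) (vspace W a)"
  proof (rule inj_onI)
    fix u u' assume u: "u \<in> vspace W a" "u' \<in> vspace W a"
      and eq: "vmap W (Star None) u = vmap W (Star None) u'"
    have "form W a u v = form W a u' v" for v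
    proof (cases "v \<in> vspace W a")
      case True
      then obtain y where y: "y \<in> vspace W t'" "v = vmap W (Orig None) y" using surj by blast
      then show ?thesis using psi'[OF u(1), of y] psi'[OF u(2), of y] eq by simp
    qed (simp add: vanish u)
    then have "form W a u = form W a u'" ..
    then show "u = u'"
      using iso u by (auto simp: linear_iso_between_def bij_betw_def inj_on_def)
  qed
  moreover have "is_rep scale H W" using W by (simp add: is_symm_rep_H_iff)
  ultimately show ?thesis
    unfolding epi_mono_def is_rep_H_iff using surj psi by simp
qed

lemma epi_mono_dsum:
  assumes W1: "is_symm_rep scale H W1" "epi_mono scale W1"
    and W2: "is_symm_rep scale H W2" "epi_mono scale W2"
  shows "epi_mono (prod_scale scale scale) (symm_dsum H W1 W2)"
proof -
  have "is_rep scale H W1" "is_rep scale H W2" using W1 W2 by (simp_all add: is_symm_rep_H_iff)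
  then have star: "vmap W1 (Star None) v \<in> vspace W1 h'" "vmap W2 (Star None) w \<in> vspace W2 h'"
    if "v \<in> vspace W1 a" "w \<in> vspace W2 a" for v w
    using that linear_betweenD(1) unfolding is_rep_H_iff by blast+
  have lin: "linear_between (prod_scale scale scale) (prod_scale scale scale)
      (A \<times> B) (A' \<times> B') (map_prod f g)"
    if "linear_between scale scale A A' f" "linear_between scale scale B B' g" for f g A B A' B'
    using that by (auto simp: linear_between_def prod_scale_def)
  show ?thesis
    unfolding epi_mono_def symm_dsum_def
    using W1(2) W2(2) star unfolding epi_mono_def
    by (auto simp: star_ends_H algebra_simps simp del: map_prod_simp
        intro!: lin map_prod_inj_on map_prod_surj_on) (simp_all add: algebra_simps)
qed

lemma deletion_dsum: "deletion \<phi> (symm_dsum H W1 W2) = symm_dsum G (deletion \<phi> W1) (deletion \<phi> W2)"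
  by (auto simp: deletion_def symm_dsum_def fun_eq_iff)

lemma symm_isomorphic_deletion:
  assumes W: "is_rep s1 H W" and iso: "symm_isomorphic s1 s2 H W W'"
  shows "symm_isomorphic s1 s2 G (deletion \<phi> W) (deletion \<phi> W')"
proof -
  obtain f where f: "is_rep_iso s1 s2 H W W' f"
    and ff: "\<forall>i\<in>verts H. \<forall>x\<in>vspace W i. \<forall>y\<in>vspace W (vstar H i).
          form W' i (f i x) (f (vstar H i) y) = form W i x y"
    using iso by (auto simp: symm_isomorphic_def)
  have psi: "vmap W (Orig None) x \<in> vspace W a" if "x \<in> vspace W t'" for x
    using W that linear_betweenD(1) unfolding is_rep_H_iff by blast
  have comm: "\<forall>x\<in>vspace W t'. f a (vmap W (Orig None) x) = vmap W' (Orig None) (f t' x)"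
    "\<forall>u\<in>vspace W a. f h' (vmap W (Star None) u) = vmap W' (Star None) (f a u)"
    "\<forall>\<alpha>\<in>arcs G - {Orig \<phi>}. \<forall>x\<in>vspace W (emb (tail G \<alpha>)).
        f (emb (head G \<alpha>)) (vmap W (emb \<alpha>) x) = vmap W' (emb \<alpha>) (f (emb (tail G \<alpha>)) x)"
    using f unfolding is_rep_iso_def ball_H by simp_all
  have "is_rep_iso s1 s2 G (deletion \<phi> W) (deletion \<phi> W') (\<lambda>i. f (emb i))"
    unfolding is_rep_iso_def phi_arrow_split deletion_simps phi_G
    using f comm psi unfolding is_rep_iso_def ball_H by (simp add: deletion_simps)
  then show ?thesis
    using ff unfolding symm_isomorphic_def ball_H
    by (intro exI[of _ "\<lambda>i. f (emb i)"]) (simp add: deletion_simps)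
qed

text \<open>In both representations the space at \<open>a\<close> is the image of the map at \<open>\<phi>\<close>, that is, the quotient
  of the space at \<open>t\<close> by the kernel of that map. The isomorphism at \<open>t\<close> respects these kernels and so
  induces an isomorphism at \<open>a\<close>. It preserves the form there because adjunction computes that form
  from the one at \<open>t\<close>.\<close>

lemma symm_isomorphic_of_deletion:
  assumes vs: "vector_space s1" and W: "is_symm_rep s1 H W" and eW: "epi_mono s1 W" and eU: "epi_mono s2 U"
    and iso: "symm_isomorphic s1 s2 G (deletion \<phi> W) (deletion \<phi> U)"
  shows "symm_isomorphic s1 s2 H W U"
proof -
  let ?p = "vmap W (Orig None)" and ?q = "vmap W (Star None)"
  let ?p' = "vmap U (Orig None)" and ?q' = "vmap U (Star None)"
  obtain f where f: "is_rep_iso s1 s2 G (deletion \<phi> W) (deletion \<phi> U) f"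
    and ff: "\<forall>i\<in>verts G. \<forall>x\<in>vspace W (emb i). \<forall>y\<in>vspace W (emb (vstar G i)).
          form U (emb i) (f i x) (f (vstar G i) y) = form W (emb i) x y"
    using iso by (auto simp: symm_isomorphic_def deletion_simps)
  have ft: "linear_iso_between s1 s2 (vspace W t') (vspace U t') (f t)"
    and fh: "linear_iso_between s1 s2 (vspace W h') (vspace U h') (f h)"
    using f in_G unfolding is_rep_iso_def deletion_simps by (metis dbl.map(1))+
  have fphi: "f h (?q (?p x)) = ?q' (?p' (f t x))" if "x \<in> vspace W t'" for x
    using f that unfolding is_rep_iso_def phi_arrow_split phi_G deletion_simps by simp
  have ff_t: "form U t' (f t x) (f h y) = form W t' x y" if "x \<in> vspace W t'" "y \<in> vspace W h'" for x y
    using bspec[OF ff in_G(1)] that by (simp add: star_ends)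
  have rep: "is_rep s1 H W" using W by (simp add: is_symm_rep_H_iff)
  then have fdT: "fin_dim_subspace s1 (vspace W t')"
    using in_G(1) unfolding is_rep_H_iff by (metis dbl.map(1))
  note closT = fin_dim_subspace_closed(1,2)[OF vs fdT]
  have ft_lin: "linear_between s1 s2 (vspace W t') (vspace U t') (f t)"
    and ft_im: "f t ` vspace W t' = vspace U t'"
    using ft by (auto simp: linear_iso_between_def bij_betw_def)
  have p_lin: "linear_between s1 s1 (vspace W t') (vspace W a) ?p" and p_im: "?p ` vspace W t' = vspace W a"
    and q_inj: "inj_on ?q (vspace W a)"
    using eW by (auto simp: epi_mono_def)
  have p'_lin: "linear_between s2 s2 (vspace U t') (vspace U a) ?p'" and p'_im: "?p' ` vspace U t' = vspace U a"
    and q'_inj: "inj_on ?q' (vspace U a)"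
    using eU by (auto simp: epi_mono_def)
  have q_in: "?q u \<in> vspace W h'" if "u \<in> vspace W a" for u
    using rep that linear_betweenD(1) unfolding is_rep_H_iff by blast
  have fh_inj: "f h x = f h y \<longleftrightarrow> x = y" if "x \<in> vspace W h'" "y \<in> vspace W h'" for x y
    using fh that by (auto simp: linear_iso_between_def bij_betw_def inj_on_def)
  have ft_in: "f t x \<in> vspace U t'" and p_in: "?p x \<in> vspace W a" and p'_in: "?p' (f t x) \<in> vspace U a"
    if "x \<in> vspace W t'" for x
    using that ft_im p_im p'_im by blast+
  have ker: "?p' (f t x) = ?p' (f t y) \<longleftrightarrow> ?p x = ?p y" if "x \<in> vspace W t'" "y \<in> vspace W t'" for x y
  proof -
    have "?p' (f t x) = ?p' (f t y) \<longleftrightarrow> ?q' (?p' (f t x)) = ?q' (?p' (f t y))"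
      using inj_on_eq_iff[OF q'_inj] p'_in that by simp
    also have "\<dots> \<longleftrightarrow> f h (?q (?p x)) = f h (?q (?p y))" using fphi that by simp
    also have "\<dots> \<longleftrightarrow> ?p x = ?p y"
      using fh_inj q_in p_in that inj_on_eq_iff[OF q_inj] by simp
    finally show ?thesis .
  qed
  define fa where "fa u = ?p' (f t (inv_into (vspace W t') ?p u))" for u
  have fa: "fa (?p x) = ?p' (f t x)" if "x \<in> vspace W t'" for x
    unfolding fa_def using that by (subst ker) (auto intro: inv_into_into f_inv_into_f)
  have fa_lin: "linear_between s1 s2 (vspace W a) (vspace U a) fa"
    unfolding linear_between_def p_im[symmetric]
  proof (intro conjI ballI allI; elim imageE; hypsubst)
    fix x assume x: "x \<in> vspace W t'"
    show "fa (?p x) \<in> vspace U a" using x by (simp add: fa p'_in)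
    show "fa (s1 c (?p x)) = s2 c (fa (?p x))" for c
      unfolding linear_betweenD(3)[OF p_lin x, symmetric]
      using x closT(2) linear_betweenD(3)[OF ft_lin x] linear_betweenD(3)[OF p'_lin ft_in[OF x]]
      by (simp add: fa)
    fix y assume y: "y \<in> vspace W t'"
    show "fa (?p x + ?p y) = fa (?p x) + fa (?p y)"
      unfolding linear_betweenD(2)[OF p_lin x y, symmetric]
      using x y closT(1) linear_betweenD(2)[OF ft_lin x y] linear_betweenD(2)[OF p'_lin ft_in[OF x] ft_in[OF y]]
      by (simp add: fa)
  qed
  have "inj_on fa (vspace W a)"
    unfolding p_im[symmetric] by (rule inj_onI) (auto simp: fa ker)
  moreover have "fa ` vspace W a = vspace U a"
    unfolding p_im[symmetric] p'_im[symmetric] ft_im[symmetric] image_image by (simp add: fa)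
  ultimately have fa_iso: "linear_iso_between s1 s2 (vspace W a) (vspace U a) fa"
    using fa_lin by (simp add: linear_iso_between_def bij_betw_def)
  have fa_q: "f h (?q u) = ?q' (fa u)" if "u \<in> vspace W a" for u
    using that unfolding p_im[symmetric] by (auto simp: fa fphi)
  have fa_form: "form U a (fa u) (fa v) = form W a u v" if u: "u \<in> vspace W a" and v: "v \<in> vspace W a" for u v
  proof -
    obtain x where x: "x \<in> vspace W t'" "u = ?p x" using u p_im by blast
    have "fa v \<in> vspace U a" using linear_betweenD(1)[OF fa_lin v] .
    then have "form U a (fa u) (fa v) = \<epsilon> * form U t' (f t x) (?q' (fa v))"
      using eU ft_in[OF x(1)] unfolding epi_mono_def x(2) fa[OF x(1)] by blast
    also have "\<dots> = \<epsilon> * form W t' x (?q v)" using ff_t[OF x(1) q_in[OF v]] fa_q[OF v] by simp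
    also have "\<dots> = form W a u v" using eW x v unfolding epi_mono_def by simp
    finally show ?thesis .
  qed
  define F where "F i = (if i = a then fa else f (map_dbl the i))" for i
  have F: "F a = fa" "F (emb i) = f i" "F (Orig (Some k)) = f (Orig k)" for i k
    by (simp_all add: F_def)
  have "is_rep_iso s1 s2 H W U F"
    using f fa_iso fa_q fa unfolding is_rep_iso_def ball_H phi_arrow_split by (simp add: F deletion_simps)
  moreover have "\<forall>i\<in>verts H. \<forall>x\<in>vspace W i. \<forall>y\<in>vspace W (vstar H i).
      form U i (F i x) (F (vstar H i) y) = form W i x y"
    unfolding ball_H vstar_new vstar_emb F using ff fa_form by blast
  ultimately show ?thesis unfolding symm_isomorphic_def by blast
qed

section \<open>Decompositions\<close>

lemma nonzero_rep_deletion: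
  assumes W: "is_rep scale H W"
    and vs: "vector_space scale" and surj: "vmap W (Orig None) ` vspace W t' = vspace W a"
  shows "nonzero_rep G (deletion \<phi> W) \<longleftrightarrow> nonzero_rep H W"
proof
  assume "nonzero_rep G (deletion \<phi> W)"
  then show "nonzero_rep H W" by (auto simp: nonzero_rep_def deletion_simps verts_H)
next
  interpret vector_space scale by fact
  have lin: "linear_between scale scale (vspace W t') (vspace W a) (vmap W (Orig None))"
    using W by (simp add: is_rep_H_iff)
  have "vspace W a = {0}" if "vspace W t' = {0}"
    using that surj linear_betweenD(2)[OF lin, of 0 0] by auto
  moreover assume "nonzero_rep H W"
  ultimately show "nonzero_rep G (deletion \<phi> W)"
    using in_G(1) unfolding nonzero_rep_def deletion_simps verts_H by (metis dbl.map(1) imageE insertE)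
qed

text \<open>Surjectivity at \<open>\<psi>\<close> is invariant under isomorphism, and a product of nonempty sets
  determines its factors.\<close>

lemma dsum_surj:
  assumes surj: "vmap W (Orig None) ` vspace W t' = vspace W a"
    and iso: "symm_isomorphic scale s2 H W (symm_dsum H W1 W2)"
    and rep: "is_symm_rep scale H W1" "is_symm_rep scale H W2" and vs: "vector_space scale"
  shows "vmap W1 (Orig None) ` vspace W1 t' = vspace W1 a" "vmap W2 (Orig None) ` vspace W2 t' = vspace W2 a"
proof -
  let ?p1 = "vmap W1 (Orig None)" and ?p2 = "vmap W2 (Orig None)" and ?p = "vmap W (Orig None)"
  interpret vector_space scale by fact
  obtain f where f: "is_rep_iso scale s2 H W (symm_dsum H W1 W2) f"
    using iso by (auto simp: symm_isomorphic_def)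
  have fa: "f a ` vspace W a = vspace W1 a \<times> vspace W2 a" and ft: "f t' ` vspace W t' = vspace W1 t' \<times> vspace W2 t'"
    using f in_H unfolding is_rep_iso_def by (auto simp: linear_iso_between_def bij_betw_def symm_dsum_def)
  have comm: "f a (?p x) = map_prod ?p1 ?p2 (f t' x)" if "x \<in> vspace W t'" for x
    using f that unfolding is_rep_iso_def ball_H by (simp add: symm_dsum_def)
  have "vspace W1 a \<times> vspace W2 a = (\<lambda>x. f a (?p x)) ` vspace W t'"
    unfolding fa[symmetric] surj[symmetric] image_image ..
  also have "\<dots> = (\<lambda>x. map_prod ?p1 ?p2 (f t' x)) ` vspace W t'" using comm by simp
  also have "\<dots> = map_prod ?p1 ?p2 ` (vspace W1 t' \<times> vspace W2 t')" unfolding ft[symmetric] image_image ..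
  also have "\<dots> = (?p1 ` vspace W1 t') \<times> (?p2 ` vspace W2 t')" by (auto simp: map_prod_def)
  finally have *: "vspace W1 a \<times> vspace W2 a = (?p1 ` vspace W1 t') \<times> (?p2 ` vspace W2 t')" .
  have "0 \<in> vspace W1 a" "0 \<in> vspace W2 a"
    using rep fin_dim_subspace_closed(3)[OF vs] subspace_0 by (auto simp: is_symm_rep_H_iff is_rep_H_iff)
  then show "?p1 ` vspace W1 t' = vspace W1 a" "?p2 ` vspace W2 t' = vspace W2 a"
    using * by (auto simp: times_eq_iff)
qed

text \<open>A decomposition of the deletion lifts by inserting the images in the two summands; a
  decomposition of \<open>W\<close> restricts.\<close>

lemma indecomposable_deletion:
  fixes scale :: "'k::field \<Rightarrow> 'b::ab_group_add \<Rightarrow> 'b"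
    and W :: "('v option dbl, 'a option dbl, 'b, 'k) form_rep"
  assumes vs: "vector_space scale" and W: "is_symm_rep scale H W"
    and surj: "vmap W (Orig None) ` vspace W t' = vspace W a"
  shows "indecomposable_symm_rep scale G (deletion \<phi> W) \<longleftrightarrow> indecomposable_symm_rep scale H W"
proof -
  have rep: "is_rep scale H X" if "is_symm_rep scale H X" for X :: "('v option dbl, 'a option dbl, 'b, 'k) form_rep"
    using that by (simp add: is_symm_rep_def)
  note nz = nonzero_rep_deletion[OF rep vs]
  have "(\<exists>V1 V2 :: ('v dbl, 'a dbl, 'b, 'k) form_rep.
      is_symm_rep scale G V1 \<and> nonzero_rep G V1 \<and> is_symm_rep scale G V2 \<and> nonzero_rep G V2 \<and>
      symm_isomorphic scale (prod_scale scale scale) G (deletion \<phi> W) (symm_dsum G V1 V2)) \<longleftrightarrow>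
    (\<exists>W1 W2 :: ('v option dbl, 'a option dbl, 'b, 'k) form_rep.
      is_symm_rep scale H W1 \<and> nonzero_rep H W1 \<and> is_symm_rep scale H W2 \<and> nonzero_rep H W2 \<and>
      symm_isomorphic scale (prod_scale scale scale) H W (symm_dsum H W1 W2))" (is "?L \<longleftrightarrow> ?R")
  proof
    assume ?L
    then obtain V1 V2 :: "('v dbl, 'a dbl, 'b, 'k) form_rep"
      where V: "is_symm_rep scale G V1" "nonzero_rep G V1" "is_symm_rep scale G V2" "nonzero_rep G V2"
      and iso: "symm_isomorphic scale (prod_scale scale scale) G (deletion \<phi> W) (symm_dsum G V1 V2)"
      by blast
    let ?W1 = "factor_rep V1" and ?W2 = "factor_rep V2"
    have W12: "is_symm_rep scale H ?W1" "is_symm_rep scale H ?W2"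
      using V by (simp_all add: is_symm_rep_factor_rep[OF vs])
    have "nonzero_rep H ?W1" "nonzero_rep H ?W2"
      using V nz[OF _ factor_rep_surj] W12 by simp_all
    moreover have "epi_mono (prod_scale scale scale) (symm_dsum H ?W1 ?W2)"
      using W12 by (intro epi_mono_dsum epi_mono_if_surj factor_rep_surj)
    then have "symm_isomorphic scale (prod_scale scale scale) H W (symm_dsum H ?W1 ?W2)"
      using iso by (intro symm_isomorphic_of_deletion[OF vs W epi_mono_if_surj[OF W surj]])
        (simp_all add: deletion_dsum)
    ultimately show ?R using W12 by blast
  next
    assume ?R
    then obtain W1 W2 :: "('v option dbl, 'a option dbl, 'b, 'k) form_rep"
      where W12: "is_symm_rep scale H W1" "nonzero_rep H W1" "is_symm_rep scale H W2" "nonzero_rep H W2"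
      and iso: "symm_isomorphic scale (prod_scale scale scale) H W (symm_dsum H W1 W2)"
      by blast
    note s12 = dsum_surj[OF surj iso W12(1,3) vs]
    have "nonzero_rep G (deletion \<phi> W1)" "nonzero_rep G (deletion \<phi> W2)"
      using nz s12 W12 by simp_all
    moreover have "symm_isomorphic scale (prod_scale scale scale) G (deletion \<phi> W)
        (symm_dsum G (deletion \<phi> W1) (deletion \<phi> W2))"
      using symm_isomorphic_deletion[OF rep[OF W] iso] by (simp add: deletion_dsum)
    ultimately show ?L using W12 is_symm_rep_deletion by blast
  qed
  then show ?thesis
    unfolding indecomposable_symm_rep_def using W is_symm_rep_deletion[OF W] nz[OF W surj] by simp
qed

end

lemma symm_isomorphic_refl: "symm_isomorphic scale scale G V V"
proof -
  have "is_rep_iso scale scale G V V (\<lambda>_ x. x)"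
    by (auto simp: is_rep_iso_def linear_iso_between_def linear_between_def bij_betw_def)
  then show ?thesis unfolding symm_isomorphic_def by blast
qed

theorem proposition5p9:
  fixes scale :: "'k::{alg_closed_field, field_char_0} \<Rightarrow> 'b::ab_group_add \<Rightarrow> 'b"
    and Q :: "('v, 'a) signed_quiver"
    and \<phi> :: 'a
  assumes "vector_space scale"
    and "signed_quiver Q"
    and "\<phi> \<in> arcs Q"
    and "asign Q \<phi> \<noteq> 0"
    and "tail Q \<phi> \<noteq> head Q \<phi>"
  shows
    "(\<forall>W :: ('v option dbl, 'a option dbl, 'b, 'k) form_rep.
        indecomposable_symm_rep scale (assoc_symm_quiver (insertion \<phi> Q)) W \<and>
        vmap W (Orig None) ` vspace W (Orig (Some (tail Q \<phi>))) = vspace W (Orig None) \<longrightarrow>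
        indecomposable_symm_rep scale (assoc_symm_quiver Q) (deletion \<phi> W)) \<and>
     (\<forall>V :: ('v dbl, 'a dbl, 'b, 'k) form_rep.
        indecomposable_symm_rep scale (assoc_symm_quiver Q) V \<longrightarrow>
        (\<exists>W :: ('v option dbl, 'a option dbl, 'b, 'k) form_rep.
           indecomposable_symm_rep scale (assoc_symm_quiver (insertion \<phi> Q)) W \<and>
           vmap W (Orig None) ` vspace W (Orig (Some (tail Q \<phi>))) = vspace W (Orig None) \<and>
           symm_isomorphic scale scale (assoc_symm_quiver Q) V (deletion \<phi> W)))"
proof -
  interpret signed_arrow_insertion Q \<phi>
    using assms(2-5) by (rule signed_arrow_insertion.intro)
  show ?thesis
  proof (intro conjI allI impI)
    fix W :: "('v option dbl, 'a option dbl, 'b, 'k) form_rep"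
    assume "indecomposable_symm_rep scale H W \<and> vmap W (Orig None) ` vspace W t' = vspace W (Orig None)"
    then show "indecomposable_symm_rep scale G (deletion \<phi> W)"
      using indecomposable_deletion[OF assms(1)] unfolding indecomposable_symm_rep_def[of _ H] by blast
  next
    fix V :: "('v dbl, 'a dbl, 'b, 'k) form_rep"
    assume V: "indecomposable_symm_rep scale G V"
    then have "is_symm_rep scale H (factor_rep V)"
      using is_symm_rep_factor_rep[OF assms(1)] unfolding indecomposable_symm_rep_def by blast
    then have "indecomposable_symm_rep scale H (factor_rep V)"
      using indecomposable_deletion[OF assms(1) _ factor_rep_surj] V by simp
    moreover have "symm_isomorphic scale scale G V (deletion \<phi> (factor_rep V))"
      by (simp add: symm_isomorphic_refl)
    ultimately show "\<exists>W :: ('v option dbl, 'a option dbl, 'b, 'k) form_rep.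
        indecomposable_symm_rep scale H W \<and>
        vmap W (Orig None) ` vspace W t' = vspace W (Orig None) \<and>
        symm_isomorphic scale scale G V (deletion \<phi> W)"
      by (intro exI[of _ "factor_rep V"] conjI factor_rep_surj)
  qed
qed

end
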